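(* Let $y,q$ be indeterminates and define $\lambda_n=(1+q^ny)(1+q^ny^{-1})$ for odd $n\ge1$ and $\lambda_n=(1-q^n)^2$ for even $n\ge 2$. Then, as formal power series in $z$, \[ \sum_{k=0}^{\infty}z^k\sum_{j=-k}^{k}y^jq^{k(k+1)-j^2} =\cfrac{1}{1+z-\cfrac{\lambda_1 z}{1+z-\cfrac{\lambda_2 z}{1+z-\cfrac{\lambda_3 z}{1+z-\cdots}}}}. \]
   Context: The infinite continued fraction (a "T-fraction") is understood as a formal power series in $z$, the limit of its finite truncations in the $z$-adic topology. *)

theory Defs
  imports "HOL-Computational_Algebra.Computational_Algebra"
begin

text \<open>
  Coefficients live in \<open>Frac(\<int>[q][y]) = \<rat>(q, y)\<close>, which contains the ring
  \<open>\<int>[q, y, y\<^sup>-\<^sup>1]\<close>; the indeterminate \<open>z\<close> is \<^const>\<open>fps_X\<close>.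
\<close>

type_synonym rat_fun_qy = "int poly poly fract"

definition y_ind :: rat_fun_qy where
  "y_ind = Fract [:0, 1:] 1"

definition q_ind :: rat_fun_qy where
  "q_ind = Fract [:[:0, 1:]:] 1"

text \<open>Only the values at \<open>n \<ge> 1\<close> are meaningful.\<close>

definition lam :: "'a::field \<Rightarrow> 'a \<Rightarrow> nat \<Rightarrow> 'a" where
  "lam y q n =
     (if odd n then (1 + q ^ n * y) * (1 + q ^ n * inverse y) else (1 - q ^ n)\<^sup>2)"

text \<open>
  \<open>T_convergent c m n\<close> is
  \<open>1 / (1 + z - c\<^sub>m z / (1 + z - c\<^sub>m\<^sub>+\<^sub>1 z / (\<dots> - c\<^sub>m\<^sub>+\<^sub>n\<^sub>-\<^sub>1 z / (1 + z))))\<close>,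
  the truncation after \<open>n\<close> partial numerators of the T-fraction starting at \<open>c\<^sub>m\<close>. All
  denominators have constant term 1, so the divisions are by units.
\<close>

fun T_convergent :: "(nat \<Rightarrow> 'a::field) \<Rightarrow> nat \<Rightarrow> nat \<Rightarrow> 'a fps" where
  "T_convergent c m 0 = 1 / (1 + fps_X)"
| "T_convergent c m (Suc n) =
     1 / (1 + fps_X - fps_const (c m) * fps_X * T_convergent c (Suc m) n)"

text \<open>
  The topology on \<^typ>\<open>'a fps\<close> is the \<open>z\<close>-adic one, whatever the coefficient type.
\<close>

definition T_fraction_has_value :: "(nat \<Rightarrow> 'a::field) \<Rightarrow> 'a fps \<Rightarrow> bool" where
  "T_fraction_has_value c F \<longleftrightarrow> (\<lambda>n. T_convergent c 1 n) \<longlonglongrightarrow> F"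

end

theory Submission
  imports Defs
begin

text \<open>
  Put \<open>p = q\<^sup>2\<close> and \<open>K\<^sub>k(z) = z\<^sup>k (1 + z) / \<Prod>i\<le>k. (1 + p\<^sup>i z) (p\<^sup>i + z)\<close>. The left-hand side \<open>S\<close> expands as
  \<open>\<Sum>k. p\<^sup>k \<lambda>\<^sub>1 \<lambda>\<^sub>3 \<cdots> \<lambda>\<^bsub>2k-1\<^esub> K\<^sub>k\<close>: both series satisfy
  \<open>(1 - q y z) (1 - q z / y) (S(z) - p z S(p z)) = 1 - p z\<^sup>2\<close>, which determines \<open>S\<close>. For the coefficient
  sequence this is a first-order recurrence; for the expansion the left-hand side telescopes, because
  \<open>(1 + p\<^bsup>k+1\<^esup> z) (p\<^sup>k + z) = p\<^sup>k (1 - q y z) (1 - q z / y) + \<lambda>\<^bsub>2k+1\<^esub> z\<close>.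

  Inserting Gaussian binomial coefficients into the expansion produces an explicit solution of
  \<open>G\<^sub>m = (1 + z) G\<^bsub>m+1\<^esub> - \<lambda>\<^bsub>m+1\<^esub> z G\<^bsub>m+2\<^esub>\<close> with \<open>G\<^sub>0 = 1\<close> and \<open>G\<^sub>1 = S\<close>, and any such
  solution makes \<open>G\<^sub>1\<close> the value of the T-fraction.
\<close>

section \<open>Adic convergence of formal power series\<close>

lemma fps_X_power_dvd_iff: "fps_X ^ n dvd f \<longleftrightarrow> (\<forall>j<n. f $ j = 0)"
  for f :: "'a::comm_ring_1 fps"
proof
  assume "\<forall>j<n. f $ j = 0"
  then have "f = fps_X ^ n * fps_shift n f"
    by (simp add: fps_eq_iff fps_X_power_mult_nth)
  then show "fps_X ^ n dvd f" ..
qed (auto simp: fps_X_power_mult_nth elim!: dvdE)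

lemma fps_X_power_mult_shift:
  fixes f :: "'a::comm_ring_1 fps"
  assumes "fps_X ^ n dvd f"
  shows "fps_X ^ n * fps_shift n f = f"
  using assms by (simp add: fps_X_power_dvd_iff fps_eq_iff fps_X_power_mult_nth)

lemma tendsto_fps_dvdI:
  fixes F :: "nat \<Rightarrow> 'a::comm_ring_1 fps"
  assumes "\<And>n. fps_X ^ n dvd F n - G"
  shows "F \<longlonglongrightarrow> G"
proof (rule tendsto_fpsI)
  fix j
  have "F n $ j = G $ j" if "n > j" for n
    using assms[of n] that by (simp add: fps_X_power_dvd_iff)
  then show "\<forall>\<^sub>F n in sequentially. F n $ j = G $ j"
    using eventually_gt_at_top[of j] by (rule eventually_mono[rotated])
qed

lemma fps_nth_suminf:
  fixes f :: "nat \<Rightarrow> 'a::comm_ring_1 fps"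
  assumes dvd: "\<And>k. fps_X ^ k dvd f k" and "n \<le> N"
  shows "(\<Sum>k. f k) $ n = (\<Sum>k\<le>N. f k $ n)"
proof -
  let ?S = "Abs_fps (\<lambda>j. \<Sum>k\<le>j. f k $ j)"
  have sum_extend: "(\<Sum>k\<le>M. f k $ j) = (\<Sum>k\<le>j. f k $ j)" if "j \<le> M" for j M
    using dvd that by (intro sum.mono_neutral_right) (auto simp: fps_X_power_dvd_iff)
  have "fps_X ^ M dvd (\<Sum>k\<le>M. f k) - ?S" for M
    by (simp add: fps_X_power_dvd_iff fps_sum_nth sum_extend[of _ M])
  then have "f sums ?S"
    unfolding sums_def_le by (rule tendsto_fps_dvdI)
  then have "(\<Sum>k. f k) = ?S"
    by (rule sums_unique[symmetric])
  then show ?thesis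
    using sum_extend[OF \<open>n \<le> N\<close>] by (simp only: fps_nth_Abs_fps)
qed

lemma fps_suminf_mult:
  fixes f :: "nat \<Rightarrow> 'a::comm_ring_1 fps"
  assumes "\<And>k. fps_X ^ k dvd f k"
  shows "(\<Sum>k. c * f k) = c * (\<Sum>k. f k)"
proof (rule fps_ext)
  fix n
  have "(c * (\<Sum>k. f k)) $ n = (\<Sum>i=0..n. c $ i * (\<Sum>k\<le>n. f k $ (n - i)))"
    using assms by (simp add: fps_mult_nth fps_nth_suminf[of _ _ n])
  also have "\<dots> = (\<Sum>k\<le>n. (c * f k) $ n)"
    by (simp only: fps_mult_nth sum_distrib_left) (rule sum.swap)
  also have "\<dots> = (\<Sum>k. c * f k) $ n"
    using assms by (subst fps_nth_suminf[OF _ order_refl]) (rule dvd_mult, simp_all)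
  finally show "(\<Sum>k. c * f k) $ n = (c * (\<Sum>k. f k)) $ n" ..
qed

lemma fps_suminf_diff:
  fixes f g :: "nat \<Rightarrow> 'a::comm_ring_1 fps"
  assumes "\<And>k. fps_X ^ k dvd f k" and "\<And>k. fps_X ^ k dvd g k"
  shows "(\<Sum>k. f k - g k) = (\<Sum>k. f k) - (\<Sum>k. g k)"
  using assms by (intro fps_ext) (simp add: fps_nth_suminf[OF _ order_refl] sum_subtractf)

lemma fps_suminf_telescope:
  fixes t :: "nat \<Rightarrow> 'a::comm_ring_1 fps"
  assumes "\<And>k. fps_X ^ k dvd t k"
  shows "(\<Sum>k. t k - t (Suc k)) = t 0"
proof (rule fps_ext)
  fix n
  have "fps_X ^ k dvd t k - t (Suc k)" for k
    using assms[of k] assms[of "Suc k"] by (simp add: fps_X_power_dvd_iff del: power_Suc)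
  then have "(\<Sum>k. t k - t (Suc k)) $ n = (\<Sum>k\<le>n. t k $ n - t (Suc k) $ n)"
    by (simp add: fps_nth_suminf[OF _ order_refl])
  also have "\<dots> = t 0 $ n - t (Suc n) $ n"
    by (rule sum_telescope)
  also have "\<dots> = t 0 $ n"
    using assms[of "Suc n"] by (simp add: fps_X_power_dvd_iff del: power_Suc)
  finally show "(\<Sum>k. t k - t (Suc k)) $ n = t 0 $ n" .
qed

section \<open>A \<open>q\<close>-difference operator\<close>

definition q_difference :: "'a::comm_ring_1 \<Rightarrow> 'a fps \<Rightarrow> 'a fps" where
  "q_difference p F = F - fps_const p * fps_X * (F oo (fps_const p * fps_X))"

lemma q_difference_nth:
  "q_difference p F $ n = F $ n - (case n of 0 \<Rightarrow> 0 | Suc m \<Rightarrow> p ^ n * F $ m)"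
  by (cases n) (simp_all add: q_difference_def mult.assoc)

lemma inj_q_difference: "inj (q_difference p)"
proof (rule injI, rule fps_ext)
  fix F G n
  assume "q_difference p F = q_difference p G"
  then have diff: "q_difference p F $ n = q_difference p G $ n" for n
    by simp
  show "F $ n = G $ n"
  proof (induction n)
    case 0
    then show ?case
      using diff[of 0] by (simp add: q_difference_nth)
  next
    case (Suc n)
    then show ?case
      using diff[of "Suc n"] by (simp add: q_difference_nth)
  qed
qed

lemma q_difference_const_mult: "q_difference p (fps_const c * F) = fps_const c * q_difference p F"
  by (rule fps_ext) (simp add: q_difference_nth algebra_simps split: nat.split)

lemma fps_X_power_dvd_q_difference: "fps_X ^ k dvd F \<Longrightarrow> fps_X ^ k dvd q_difference p F"
  by (auto simp: fps_X_power_dvd_iff q_difference_nth split: nat.split)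

lemma q_difference_suminf:
  fixes f :: "nat \<Rightarrow> 'a::comm_ring_1 fps"
  assumes "\<And>k. fps_X ^ k dvd f k"
  shows "q_difference p (\<Sum>k. f k) = (\<Sum>k. q_difference p (f k))"
proof (rule fps_ext)
  fix n
  have "(\<Sum>k. q_difference p (f k)) $ n = (\<Sum>k\<le>n. q_difference p (f k) $ n)"
    by (rule fps_nth_suminf) (simp_all add: fps_X_power_dvd_q_difference assms)
  also have "\<dots> = q_difference p (\<Sum>k. f k) $ n"
    using fps_nth_suminf[of f _ n, OF assms]
    by (cases n) (simp_all add: q_difference_nth sum_subtractf sum_distrib_left del: sum.atMost_Suc)
  finally show "q_difference p (\<Sum>k. f k) $ n = (\<Sum>k. q_difference p (f k)) $ n" ..
qed

section \<open>T-fractions from three-term recurrences\<close>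

lemma fps_X_power_Suc_dvd_quotient_error:
  fixes T :: "'a::comm_ring_1 fps"
  assumes inv: "T * (1 + fps_X - c * fps_X * A) = 1" and rec: "F = (1 + fps_X) * G - c * fps_X * H"
    and dvd: "fps_X ^ n dvd A * G - H"
  shows "fps_X ^ Suc n dvd T * F - G"
proof -
  have "T * F - G = T * F - T * (1 + fps_X - c * fps_X * A) * G"
    by (simp only: inv mult_1)
  also have "\<dots> = T * c * (fps_X * (A * G - H))"
    unfolding rec by (simp add: algebra_simps)
  finally show ?thesis
    using dvd by (simp add: dvd_mult mult_dvd_mono)
qed

lemma fps_X_power_dvd_T_convergent_error:
  fixes G :: "nat \<Rightarrow> 'a::field fps"
  assumes rec: "\<And>m. G m =
      (1 + fps_X) * G (Suc m) - fps_const (c (Suc m)) * fps_X * G (Suc (Suc m))"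
  shows "fps_X ^ Suc n dvd T_convergent c (Suc m) n * G m - G (Suc m)"
proof (induction n arbitrary: m)
  case 0
  have "T_convergent c (Suc m) 0 * (1 + fps_X - fps_const (c (Suc m)) * fps_X * 0) = 1"
    by (simp add: fps_divide_unit inverse_mult_eq_1)
  from fps_X_power_Suc_dvd_quotient_error[OF this rec[of m], of 0] show ?case
    by simp
next
  case (Suc n)
  have "T_convergent c (Suc m) (Suc n) *
      (1 + fps_X - fps_const (c (Suc m)) * fps_X * T_convergent c (Suc (Suc m)) n) = 1"
    by (simp add: fps_divide_unit inverse_mult_eq_1)
  from fps_X_power_Suc_dvd_quotient_error[OF this rec[of m] Suc.IH[of "Suc m"]] show ?case .
qed

lemma T_fraction_has_valueI:
  fixes G :: "nat \<Rightarrow> 'a::field fps"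
  assumes G_0: "G 0 = 1"
    and rec: "\<And>m. G m =
      (1 + fps_X) * G (Suc m) - fps_const (c (Suc m)) * fps_X * G (Suc (Suc m))"
  shows "T_fraction_has_value c (G 1)"
  unfolding T_fraction_has_value_def
proof (rule tendsto_fps_dvdI)
  fix n
  have "fps_X ^ Suc n dvd T_convergent c 1 n - G 1"
    using fps_X_power_dvd_T_convergent_error[of G c n 0, OF rec] by (simp add: G_0)
  then show "fps_X ^ n dvd T_convergent c 1 n - G 1"
    unfolding power_Suc by (rule dvd_mult_right)
qed

section \<open>A kernel basis\<close>

definition kernel_den :: "'a::field \<Rightarrow> nat \<Rightarrow> 'a fps" where
  "kernel_den p k = (1 + fps_const (p ^ k) * fps_X) * (fps_const (p ^ k) + fps_X)"

primrec kernel :: "'a::field \<Rightarrow> nat \<Rightarrow> 'a fps" where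
  "kernel p 0 = inverse (1 + fps_X)"
| "kernel p (Suc k) = fps_X * kernel p k * inverse (kernel_den p (Suc k))"

lemma kernel_0_mult: "(1 + fps_X) * kernel p 0 = 1"
  by (simp add: inverse_mult_eq_1')

lemma kernel_Suc_mult:
  assumes "p \<noteq> 0"
  shows "kernel_den p (Suc k) * kernel p (Suc k) = fps_X * kernel p k"
proof -
  have "kernel_den p (Suc k) * inverse (kernel_den p (Suc k)) = 1"
    using assms by (intro inverse_mult_eq_1') (simp add: kernel_den_def)
  then show ?thesis
    by (simp add: mult.left_commute[of "kernel_den p (Suc k)"])
qed

lemma fps_X_power_dvd_kernel: "fps_X ^ k dvd kernel p k"
  by (induction k) (simp_all add: dvd_mult2 mult_dvd_mono)

declare kernel.simps [simp del]

lemma kernel_den_expand: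
  "kernel_den p k = fps_const (p ^ k) * (1 + fps_X)\<^sup>2 + fps_const ((p ^ k - 1)\<^sup>2) * fps_X"
proof -
  have const: "fps_const ((p ^ k - 1)\<^sup>2) = (fps_const (p ^ k) - 1)\<^sup>2"
    by (simp flip: fps_const_power fps_const_sub)
  show ?thesis
    unfolding kernel_den_def const by algebra
qed

lemma kernel_compose_linear:
  assumes "p \<noteq> 0"
  shows "(1 + fps_const (p ^ Suc k) * fps_X) * (kernel p k oo (fps_const p * fps_X)) =
    (fps_const (p ^ k) + fps_X) * kernel p k"
proof (induction k)
  case 0
  have "(1 + fps_const (p ^ Suc 0) * fps_X) * (kernel p 0 oo (fps_const p * fps_X)) =
      ((1 + fps_X) * kernel p 0) oo (fps_const p * fps_X)"
    by (simp add: fps_compose_mult_distrib fps_compose_add_distrib)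
  also have "\<dots> = (1 + fps_X) * kernel p 0"
    by (simp only: kernel_0_mult fps_compose_1)
  finally show ?case
    by (simp only: power_0 fps_const_1_eq_1)
next
  case (Suc k)
  let ?P = "\<lambda>k. 1 + fps_const (p ^ k) * fps_X" and ?R = "\<lambda>k. fps_const (p ^ k) + fps_X"
  let ?K = "kernel p" and ?K' = "\<lambda>k. kernel p k oo (fps_const p * fps_X)"
  have nonzero: "?P (Suc k) \<noteq> 0" "?R k \<noteq> 0"
    using assms by (auto intro!: fps_nonzeroI[of _ 0])
  have "fps_const p * (?P (Suc (Suc k)) * ?R k * ?K' (Suc k)) =
      (kernel_den p (Suc k) * ?K (Suc k)) oo (fps_const p * fps_X)"
    by (simp add: kernel_den_def fps_compose_mult_distrib fps_compose_add_distrib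
        algebra_simps flip: fps_const_mult)
  also have "\<dots> = fps_const p * (fps_X * ?K' k)"
    unfolding kernel_Suc_mult[OF assms] by (simp add: fps_compose_mult_distrib mult.assoc)
  finally have dilated: "?P (Suc (Suc k)) * ?R k * ?K' (Suc k) = fps_X * ?K' k"
    using assms by simp
  have "?P (Suc k) * ?R k * (?P (Suc (Suc k)) * ?K' (Suc k)) =
      ?P (Suc k) * (?P (Suc (Suc k)) * ?R k * ?K' (Suc k))"
    by (simp only: ac_simps)
  also have "\<dots> = fps_X * (?P (Suc k) * ?K' k)"
    unfolding dilated by (simp only: ac_simps)
  also have "\<dots> = ?R k * (kernel_den p (Suc k) * ?K (Suc k))"
    by (simp only: Suc.IH kernel_Suc_mult[OF assms] mult.left_commute)
  also have "\<dots> = ?P (Suc k) * ?R k * (?R (Suc k) * ?K (Suc k))"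
    by (simp only: kernel_den_def ac_simps)
  finally show ?case
    using nonzero by (simp only: mult_left_cancel mult_eq_0_iff simp_thms)
qed

lemma kernel_q_difference:
  assumes "p \<noteq> 0"
  shows "(1 + fps_const (p ^ Suc k) * fps_X) * q_difference p (kernel p k) =
    (1 - fps_const p * fps_X\<^sup>2) * kernel p k"
proof -
  let ?P = "1 + fps_const (p ^ Suc k) * fps_X"
  have "?P * q_difference p (kernel p k) =
      ?P * kernel p k - fps_const p * fps_X * (?P * (kernel p k oo (fps_const p * fps_X)))"
    by (simp only: q_difference_def algebra_simps)
  also have "\<dots> = (1 - fps_const p * fps_X\<^sup>2) * kernel p k"
    unfolding kernel_compose_linear[OF assms]
    by (simp add: algebra_simps power2_eq_square flip: fps_const_mult)
  finally show ?thesis .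
qed

lemma square_mult_kernel_Suc:
  assumes "p \<noteq> 0"
  shows "(1 + fps_X)\<^sup>2 * (fps_const (p ^ Suc k) * kernel p (Suc k)) =
    fps_X * (kernel p k - fps_const ((p ^ Suc k - 1)\<^sup>2) * kernel p (Suc k))"
  using kernel_Suc_mult[OF assms, of k] unfolding kernel_den_expand by (simp only: algebra_simps)

definition kernel_series :: "'a::field \<Rightarrow> (nat \<Rightarrow> 'a) \<Rightarrow> 'a fps" where
  "kernel_series p a = (\<Sum>k. fps_const (p ^ k * a k) * kernel p k)"

lemma fps_X_power_dvd_kernel_mult: "fps_X ^ k dvd c * kernel p k"
  by (rule dvd_mult) (rule fps_X_power_dvd_kernel)

lemma kernel_series_diff:
  "kernel_series p (\<lambda>k. a k - c * b k) = kernel_series p a - fps_const c * kernel_series p b"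
proof -
  have "fps_const (p ^ k * (a k - c * b k)) * kernel p k =
      fps_const (p ^ k * a k) * kernel p k - fps_const c * (fps_const (p ^ k * b k) * kernel p k)"
    for k
    by (simp add: algebra_simps flip: fps_const_mult fps_const_sub)
  then show ?thesis
    by (simp add: kernel_series_def fps_suminf_diff fps_suminf_mult fps_X_power_dvd_kernel_mult
        dvd_mult)
qed

lemma fps_X_power_dvd_kernel_series:
  assumes "\<And>k. k < n \<Longrightarrow> a k = 0"
  shows "fps_X ^ n dvd kernel_series p a"
  unfolding kernel_series_def fps_X_power_dvd_iff
  by (simp add: fps_nth_suminf[OF _ order_refl] fps_X_power_dvd_kernel_mult assms)

lemma kernel_series_recurrence:
  assumes "p \<noteq> 0" and b_0: "b 0 = 0"
    and b: "\<And>k. p ^ k * a k = b (Suc k) - (p ^ k - 1)\<^sup>2 * b k"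
  shows "(1 + fps_X)\<^sup>2 * kernel_series p b = fps_X * kernel_series p a"
proof -
  let ?A = "\<lambda>k. fps_const (p ^ k * a k) * kernel p k"
    and ?B = "\<lambda>k. fps_const (p ^ k * b k) * kernel p k"
  define t where "t k = fps_X * (case k of 0 \<Rightarrow> 0 | Suc j \<Rightarrow> fps_const (b k) * kernel p j)" for k
  have dvd_t: "fps_X ^ k dvd t k" for k
    by (cases k) (simp_all add: t_def mult_dvd_mono fps_X_power_dvd_kernel_mult)
  have "(1 + fps_X)\<^sup>2 * ?B k - fps_X * ?A k = t k - t (Suc k)" for k
  proof (cases k)
    case 0
    then show ?thesis
      using b_0 b[of 0] by (simp add: t_def)
  next
    case (Suc j)
    let ?e = "fps_const ((p ^ k - 1)\<^sup>2)"
    have "(1 + fps_X)\<^sup>2 * ?B k = fps_const (b k) * ((1 + fps_X)\<^sup>2 * (fps_const (p ^ k) * kernel p k))"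
      by (simp only: ac_simps flip: fps_const_mult)
    also have "\<dots> = fps_const (b k) * (fps_X * (kernel p j - ?e * kernel p k))"
      unfolding Suc square_mult_kernel_Suc[OF \<open>p \<noteq> 0\<close>] ..
    also have "\<dots> = t k - fps_X * (?e * fps_const (b k) * kernel p k)"
      by (simp add: t_def Suc algebra_simps)
    finally have B_k: "(1 + fps_X)\<^sup>2 * ?B k = t k - fps_X * (?e * fps_const (b k) * kernel p k)" .
    have "?A k = (fps_const (b (Suc k)) - ?e * fps_const (b k)) * kernel p k"
      by (simp add: b)
    then show ?thesis
      unfolding B_k by (simp only: t_def nat.case) (simp only: algebra_simps)
  qed
  then have "(\<Sum>k. (1 + fps_X)\<^sup>2 * ?B k - fps_X * ?A k) = 0"
    using fps_suminf_telescope[OF dvd_t] by (simp add: t_def)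
  then show ?thesis
    by (simp add: kernel_series_def fps_suminf_diff fps_suminf_mult fps_X_power_dvd_kernel_mult
        dvd_mult)
qed

section \<open>Rescaled Gaussian binomial coefficients\<close>

text \<open>
  By the \<open>q\<close>-binomial theorem, this is \<open>p\<^bsup>n(n-1)/2\<^esup>\<close> times the Gaussian binomial coefficient with
  parameter \<open>p\<close>.
\<close>

definition qbinom :: "'a::comm_ring_1 \<Rightarrow> nat \<Rightarrow> nat \<Rightarrow> 'a" where
  "qbinom p k n = poly.coeff (\<Prod>i<k. [:1, p ^ i:]) n"

lemma qbinom_0_right [simp]: "qbinom p k 0 = 1"
  by (induction k) (simp_all add: qbinom_def)

lemma qbinom_0_Suc [simp]: "qbinom p 0 (Suc n) = 0"
  by (simp add: qbinom_def)

lemma qbinom_Suc_Suc: "qbinom p (Suc k) (Suc n) = qbinom p k (Suc n) + p ^ k * qbinom p k n"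
  by (simp add: qbinom_def algebra_simps)

lemma qbinom_Suc_Suc':
  "qbinom p (Suc k) (Suc n) = p ^ Suc n * qbinom p k (Suc n) + p ^ n * qbinom p k n"
proof -
  have "(\<Prod>i<Suc k. [:1, p ^ i:]) = [:1, 1:] * pcompose (\<Prod>i<k. [:1, p ^ i:]) [:0, p:]"
    by (simp add: prod.lessThan_Suc_shift pcompose_prod pcompose_pCons mult.commute
        del: prod.lessThan_Suc)
  then show ?thesis
    by (simp add: qbinom_def coeff_pcompose_linear)
qed

lemma qbinom_less: "k < n \<Longrightarrow> qbinom p k n = 0"
proof (induction k arbitrary: n)
  case 0
  then show ?case by (cases n) simp_all
next
  case (Suc k)
  then show ?case by (cases n) (simp_all add: qbinom_Suc_Suc)
qed

lemma qbinom_Suc_right: "(p ^ Suc n - 1) * qbinom p k (Suc n) = (p ^ k - p ^ n) * qbinom p k n"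
  using qbinom_Suc_Suc[of p k n] qbinom_Suc_Suc'[of p k n] by (simp add: algebra_simps)

lemma qbinom_Suc_left:
  "(p ^ Suc k - 1) * (p ^ n * qbinom p k n) = (p ^ Suc k - p ^ n) * qbinom p (Suc k) n"
proof -
  have "(p ^ Suc k - 1) * (p ^ n * qbinom p k n) =
      p ^ Suc n * ((p ^ k - p ^ n) * qbinom p k n) + p ^ n * (p ^ Suc n - 1) * qbinom p k n"
    by (simp add: algebra_simps)
  also have "\<dots> = (p ^ Suc n - 1) * qbinom p (Suc k) (Suc n)"
    by (simp add: qbinom_Suc_Suc' flip: qbinom_Suc_right) (simp add: algebra_simps)
  finally show ?thesis
    by (simp only: qbinom_Suc_right)
qed

section \<open>The theta series\<close>

lemma fps_geometric_mult:
  "(1 - fps_const c * fps_X) * Abs_fps (\<lambda>n. c ^ n) = 1"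
  for c :: "'a::comm_ring_1"
proof (rule fps_ext)
  show "((1 - fps_const c * fps_X) * Abs_fps (\<lambda>n. c ^ n)) $ n = 1 $ n" for n
    by (cases n) (simp_all add: left_diff_distrib mult.assoc)
qed

definition theta_coeff :: "'a::field \<Rightarrow> 'a \<Rightarrow> nat \<Rightarrow> 'a" where
  "theta_coeff y q k = (\<Sum>j = - int k..int k. y powi j * q powi (int k * (int k + 1) - j\<^sup>2))"

lemma theta_coeff_0: "theta_coeff y q 0 = 1"
  by (simp add: theta_coeff_def)

lemma theta_coeff_Suc:
  fixes q y :: "'a::field"
  assumes "q \<noteq> 0"
  shows "theta_coeff y q (Suc k) =
    (q\<^sup>2) ^ Suc k * theta_coeff y q k + (q * y) ^ Suc k + (q / y) ^ Suc k"
proof -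
  let ?t = "\<lambda>k j. y powi j * q powi (int k * (int k + 1) - j\<^sup>2)"
  have interior: "?t (Suc k) j = (q\<^sup>2) ^ Suc k * ?t k j" for j
  proof -
    have "int (Suc k) * (int (Suc k) + 1) - j\<^sup>2 = int (2 * Suc k) + (int k * (int k + 1) - j\<^sup>2)"
      by (simp add: algebra_simps)
    then show ?thesis
      using assms
      by (simp only: power_int_add power_int_of_nat power_mult simp_thms mult.left_commute)
  qed
  have exponent: "int (Suc k) * (int (Suc k) + 1) - (int (Suc k))\<^sup>2 = int (Suc k)"
    by (simp add: algebra_simps power2_eq_square)
  have upper: "?t (Suc k) (int (Suc k)) = (q * y) ^ Suc k"
    by (simp only: exponent power_int_of_nat power_mult_distrib mult.commute)
  have lower: "?t (Suc k) (- int (Suc k)) = (q / y) ^ Suc k"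
    by (simp only: exponent power2_minus power_int_of_nat power_int_minus power_divide
        divide_inverse power_mult_distrib power_inverse mult.commute)
  have inner: "(\<Sum>j = - int k..int k. ?t (Suc k) j) = (q\<^sup>2) ^ Suc k * theta_coeff y q k"
    by (simp only: interior theta_coeff_def sum_distrib_left)
  have "{- int (Suc k)..int (Suc k)} =
      insert (int (Suc k)) (insert (- int (Suc k)) {- int k..int k})"
    by auto
  then have "theta_coeff y q (Suc k) =
      ?t (Suc k) (int (Suc k)) +
      (?t (Suc k) (- int (Suc k)) + (\<Sum>j = - int k..int k. ?t (Suc k) j))"
    by (simp add: theta_coeff_def)
  then show ?thesis
    unfolding upper lower inner by (simp only: ac_simps)
qed

definition theta_den :: "'a::field \<Rightarrow> 'a \<Rightarrow> 'a fps" where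
  "theta_den y q = (1 - fps_const (q * y) * fps_X) * (1 - fps_const (q / y) * fps_X)"

lemma theta_den_mult_q_difference:
  fixes q y :: "'a::field"
  assumes "q \<noteq> 0" "y \<noteq> 0"
  shows "theta_den y q * q_difference (q\<^sup>2) (Abs_fps (theta_coeff y q)) =
    1 - fps_const (q\<^sup>2) * fps_X\<^sup>2"
proof -
  let ?u = "fps_const (q * y) * fps_X" and ?v = "fps_const (q / y) * fps_X"
  let ?U = "Abs_fps (\<lambda>n. (q * y) ^ n)" and ?V = "Abs_fps (\<lambda>n. (q / y) ^ n)"
  have "q_difference (q\<^sup>2) (Abs_fps (theta_coeff y q)) $ n = (?U + ?V - 1) $ n" for n
    by (cases n) (simp_all add: q_difference_nth theta_coeff_0 theta_coeff_Suc[OF assms(1)])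
  then have "q_difference (q\<^sup>2) (Abs_fps (theta_coeff y q)) = ?U + ?V - 1"
    by (rule fps_ext)
  then have "theta_den y q * q_difference (q\<^sup>2) (Abs_fps (theta_coeff y q)) =
      (1 - ?v) * ((1 - ?u) * ?U) + (1 - ?u) * ((1 - ?v) * ?V) - (1 - ?u) * (1 - ?v)"
    unfolding theta_den_def by algebra
  also have "\<dots> = 1 - ?u * ?v"
    unfolding fps_geometric_mult by algebra
  also have "?u * ?v = fps_const (q * y) * fps_const (q / y) * fps_X\<^sup>2"
    by algebra
  also have "fps_const (q * y) * fps_const (q / y) = fps_const (q\<^sup>2)"
    using assms by (simp add: power2_eq_square)
  finally show ?thesis .
qed

section \<open>Expansion of the theta series in the kernel basis\<close>

locale theta_T_fraction =
  fixes y q p :: "'a::field"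
  assumes q_nonzero: "q \<noteq> 0" and y_nonzero: "y \<noteq> 0" and p_eq: "p = q\<^sup>2"
begin

lemma p_nonzero: "p \<noteq> 0"
  using q_nonzero by (simp add: p_eq)

lemma lam_even: "lam y q (2 * k) = (p ^ k - 1)\<^sup>2"
  by (simp add: lam_def p_eq power_mult power2_commute)

lemma lam_odd: "lam y q (Suc (2 * k)) = (1 + p ^ k * (q * y)) * (1 + p ^ k * (q / y))"
  by (simp add: lam_def p_eq power_mult) (simp add: divide_inverse mult_ac)

definition odd_lam_prod :: "nat \<Rightarrow> nat \<Rightarrow> 'a" where
  "odd_lam_prod n k = (\<Prod>i = n..<k. lam y q (Suc (2 * i)))"

lemma odd_lam_prod_Suc:
  "n \<le> k \<Longrightarrow> odd_lam_prod n (Suc k) = odd_lam_prod n k * lam y q (Suc (2 * k))"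
  by (simp add: odd_lam_prod_def)

lemma odd_lam_prod_Suc_left:
  "n < k \<Longrightarrow> odd_lam_prod n k = lam y q (Suc (2 * n)) * odd_lam_prod (Suc n) k"
  by (simp add: odd_lam_prod_def prod.atLeast_Suc_lessThan)

lemma kernel_den_theta_den:
  "(1 + fps_const (p ^ Suc k) * fps_X) * (fps_const (p ^ k) + fps_X) =
   fps_const (p ^ k) * theta_den y q + fps_const (lam y q (Suc (2 * k))) * fps_X"
proof -
  have "fps_const (p ^ Suc k) = fps_const (p ^ k) * (fps_const (q * y) * fps_const (q / y))"
    using y_nonzero by (simp add: p_eq power2_eq_square)
  moreover have "fps_const (lam y q (Suc (2 * k))) =
      (1 + fps_const (p ^ k) * fps_const (q * y)) * (1 + fps_const (p ^ k) * fps_const (q / y))"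
    unfolding lam_odd by (simp flip: fps_const_1_eq_1)
  ultimately show ?thesis
    unfolding theta_den_def by algebra
qed

definition odd_lam_kernel :: "nat \<Rightarrow> 'a fps" where
  "odd_lam_kernel k = fps_const (odd_lam_prod 0 k) * (fps_const (p ^ k) + fps_X) * kernel p k"

lemma odd_lam_kernel_diff:
  "(1 + fps_const (p ^ Suc k) * fps_X) * (odd_lam_kernel k - odd_lam_kernel (Suc k)) =
   theta_den y q * (fps_const (p ^ k * odd_lam_prod 0 k) * kernel p k)"
proof -
  let ?P = "1 + fps_const (p ^ Suc k) * fps_X" and ?E = "fps_const (p ^ k) + fps_X"
  let ?L = "fps_const (odd_lam_prod 0 k)" and ?l = "fps_const (lam y q (Suc (2 * k)))"
  have "?P * odd_lam_kernel (Suc k) = ?L * ?l * (kernel_den p (Suc k) * kernel p (Suc k))"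
    by (simp add: odd_lam_kernel_def odd_lam_prod_Suc kernel_den_def ac_simps
        flip: fps_const_mult)
  also have "\<dots> = ?L * (?l * fps_X) * kernel p k"
    unfolding kernel_Suc_mult[OF p_nonzero] by (simp only: ac_simps)
  finally have "?P * (odd_lam_kernel k - odd_lam_kernel (Suc k)) =
      ?L * (?P * ?E - ?l * fps_X) * kernel p k"
    by (simp add: odd_lam_kernel_def right_diff_distrib left_diff_distrib ac_simps)
  also have "\<dots> = theta_den y q * (fps_const (p ^ k * odd_lam_prod 0 k) * kernel p k)"
    unfolding kernel_den_theta_den by (simp add: algebra_simps flip: fps_const_mult)
  finally show ?thesis .
qed

lemma theta_den_mult_q_difference_kernel_series:
  "theta_den y q * q_difference p (kernel_series p (odd_lam_prod 0)) = 1 - fps_const p * fps_X\<^sup>2"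
proof -
  let ?R = "1 - fps_const p * fps_X\<^sup>2" and ?a = "\<lambda>k. fps_const (p ^ k * odd_lam_prod 0 k)"
  let ?t = "\<lambda>k. ?R * odd_lam_kernel k"
  have dvd: "fps_X ^ k dvd ?t k" for k
    unfolding odd_lam_kernel_def by (intro dvd_mult fps_X_power_dvd_kernel)
  have "theta_den y q * q_difference p (?a k * kernel p k) = ?t k - ?t (Suc k)" for k
  proof -
    let ?P = "1 + fps_const (p ^ Suc k) * fps_X"
    have "?P * (theta_den y q * q_difference p (?a k * kernel p k)) =
        theta_den y q * (?a k * (?P * q_difference p (kernel p k)))"
      unfolding q_difference_const_mult by (simp only: ac_simps)
    also have "\<dots> = ?R * (theta_den y q * (?a k * kernel p k))"
      unfolding kernel_q_difference[OF p_nonzero] by (simp only: ac_simps)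
    also have "\<dots> = ?P * (?t k - ?t (Suc k))"
      unfolding odd_lam_kernel_diff[symmetric] by (simp only: algebra_simps)
    finally have "?P * (theta_den y q * q_difference p (?a k * kernel p k)) =
        ?P * (?t k - ?t (Suc k))" .
    moreover have "?P \<noteq> 0"
      by (rule fps_nonzeroI[of _ 0]) simp
    ultimately show ?thesis
      by (simp only: mult_cancel_left simp_thms)
  qed
  moreover have "q_difference p (kernel_series p (odd_lam_prod 0)) =
      (\<Sum>k. q_difference p (?a k * kernel p k))"
    unfolding kernel_series_def by (rule q_difference_suminf) (rule fps_X_power_dvd_kernel_mult)
  ultimately have "theta_den y q * q_difference p (kernel_series p (odd_lam_prod 0)) =
      (\<Sum>k. ?t k - ?t (Suc k))"
    by (simp only: fps_suminf_mult[symmetric] fps_X_power_dvd_q_difference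
        fps_X_power_dvd_kernel_mult)
  also have "\<dots> = ?t 0"
    by (rule fps_suminf_telescope) (rule dvd)
  also have "odd_lam_kernel 0 = 1"
    using kernel_0_mult by (simp add: odd_lam_kernel_def odd_lam_prod_def)
  finally show ?thesis
    by simp
qed

lemma theta_series_eq_kernel_series:
  "Abs_fps (theta_coeff y q) = kernel_series p (odd_lam_prod 0)"
proof -
  have "theta_den y q \<noteq> 0"
    by (rule fps_nonzeroI[of _ 0]) (simp add: theta_den_def)
  moreover have "theta_den y q * q_difference p (Abs_fps (theta_coeff y q)) =
      theta_den y q * q_difference p (kernel_series p (odd_lam_prod 0))"
    using theta_den_mult_q_difference[OF q_nonzero y_nonzero]
    by (simp only: theta_den_mult_q_difference_kernel_series flip: p_eq)
  ultimately show ?thesis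
    using injD[OF inj_q_difference] by simp
qed

section \<open>Solving the three-term recurrence\<close>

definition odd_coeff :: "nat \<Rightarrow> nat \<Rightarrow> 'a" where
  "odd_coeff n k = odd_lam_prod n k * qbinom p k n"

fun even_coeff :: "nat \<Rightarrow> nat \<Rightarrow> 'a" where
  "even_coeff 0 k = (if k = 0 then 1 else 0)"
| "even_coeff (Suc n) 0 = 0"
| "even_coeff (Suc n) (Suc k) = odd_lam_prod (Suc n) (Suc k) * (p ^ n * qbinom p k n)"

lemma odd_coeff_less: "k < n \<Longrightarrow> odd_coeff n k = 0"
  by (simp add: odd_coeff_def qbinom_less)

lemma even_coeff_less: "k < n \<Longrightarrow> even_coeff n k = 0"
  by (cases "(n, k)" rule: even_coeff.cases) (simp_all add: qbinom_less)

lemma even_coeff_recurrence: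
  "even_coeff n k = odd_coeff n k - lam y q (Suc (2 * n)) * even_coeff (Suc n) k"
proof (cases k)
  case 0
  then show ?thesis
    by (cases n) (simp_all add: odd_coeff_def odd_lam_prod_def)
next
  case (Suc j)
  have "lam y q (Suc (2 * n)) * (odd_lam_prod (Suc n) k * (p ^ n * qbinom p j n)) =
      odd_lam_prod n k * (p ^ n * qbinom p j n)"
    using odd_lam_prod_Suc_left[of n k] by (cases "n \<le> j") (simp_all add: Suc qbinom_less)
  then have "odd_coeff n k - lam y q (Suc (2 * n)) * even_coeff (Suc n) k =
      odd_lam_prod n k * (qbinom p k n - p ^ n * qbinom p j n)"
    by (simp only: Suc odd_coeff_def even_coeff.simps right_diff_distrib)
  also have "\<dots> = even_coeff n k"
    by (cases n) (simp_all add: Suc qbinom_Suc_Suc')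
  finally show ?thesis ..
qed

lemma lam_qbinom_recurrence:
  "p ^ Suc j * (lam y q (Suc (2 * n)) * qbinom p (Suc j) n +
      lam y q (2 * Suc n) * qbinom p (Suc j) (Suc n)) =
   lam y q (Suc (2 * Suc j)) * (p ^ n * qbinom p (Suc j) n) -
      lam y q (2 * Suc j) * (p ^ n * qbinom p j n)"
proof -
  define A B b where "A = p ^ Suc j" and "B = p ^ n" and "b = qbinom p (Suc j) n"
  have p_factor: "p = q * y * (q / y)"
    using y_nonzero by (simp add: p_eq power2_eq_square)
  have lam_qbinom_Suc: "lam y q (2 * Suc n) * qbinom p (Suc j) (Suc n) = (p * B - 1) * ((A - B) * b)"
    using qbinom_Suc_right[of p n "Suc j"]
    by (simp only: lam_even power2_eq_square A_def B_def b_def power_Suc mult.assoc)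
  have lam_qbinom_pred: "lam y q (2 * Suc j) * (B * qbinom p j n) = (A - 1) * ((A - B) * b)"
    using qbinom_Suc_left[of p j n]
    by (simp only: lam_even power2_eq_square A_def B_def b_def mult.assoc)
  have "A * (lam y q (Suc (2 * n)) * b + (p * B - 1) * ((A - B) * b)) =
      lam y q (Suc (2 * Suc j)) * (B * b) - (A - 1) * ((A - B) * b)"
    unfolding lam_odd A_def[symmetric] B_def[symmetric] unfolding p_factor by algebra
  then show ?thesis
    unfolding lam_qbinom_Suc[symmetric] lam_qbinom_pred[symmetric] unfolding A_def B_def b_def .
qed

lemma odd_coeff_recurrence:
  "p ^ k * (odd_coeff n k + lam y q (2 * Suc n) * odd_coeff (Suc n) k) =
   even_coeff (Suc n) (Suc k) - (p ^ k - 1)\<^sup>2 * even_coeff (Suc n) k"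
proof -
  consider (less) "k < n" | (equal) "k = n" | (greater) j where "k = Suc j" "n < k"
    by (metis linorder_cases less_imp_Suc_add)
  then show ?thesis
  proof cases
    case less
    then show ?thesis
      by (simp add: odd_coeff_less even_coeff_less qbinom_less)
  next
    case equal
    then show ?thesis
      by (simp add: odd_coeff_def odd_lam_prod_def qbinom_less even_coeff_less)
  next
    case greater
    let ?L = "odd_lam_prod (Suc n) k"
    have "p ^ k * (odd_coeff n k + lam y q (2 * Suc n) * odd_coeff (Suc n) k) =
        ?L * (p ^ k * (lam y q (Suc (2 * n)) * qbinom p k n +
          lam y q (2 * Suc n) * qbinom p k (Suc n)))"
      unfolding odd_coeff_def odd_lam_prod_Suc_left[OF \<open>n < k\<close>] by (simp only: algebra_simps)
    also have "\<dots> = ?L * lam y q (Suc (2 * k)) * (p ^ n * qbinom p k n)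
        - lam y q (2 * k) * (?L * (p ^ n * qbinom p j n))"
      unfolding \<open>k = Suc j\<close> lam_qbinom_recurrence by (simp only: algebra_simps)
    also have "\<dots> = even_coeff (Suc n) (Suc k) - (p ^ k - 1)\<^sup>2 * even_coeff (Suc n) k"
      using \<open>n < k\<close> by (simp add: \<open>k = Suc j\<close> odd_lam_prod_Suc lam_even del: mult_Suc_right)
    finally show ?thesis .
  qed
qed

text \<open>
  Both kernel series start at \<open>z ^ (m div 2)\<close>, so the shifts are exact divisions.
\<close>

definition T_solution :: "nat \<Rightarrow> 'a fps" where
  "T_solution m =
    (if even m then (1 + fps_X) * fps_shift (m div 2) (kernel_series p (even_coeff (m div 2)))
     else fps_shift (m div 2) (kernel_series p (odd_coeff (m div 2))))"

lemma T_solution_even: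
  "fps_X ^ n * T_solution (2 * n) = (1 + fps_X) * kernel_series p (even_coeff n)"
  using fps_X_power_mult_shift[OF fps_X_power_dvd_kernel_series[OF even_coeff_less]]
  by (simp add: T_solution_def mult.left_commute)

lemma T_solution_odd: "fps_X ^ n * T_solution (Suc (2 * n)) = kernel_series p (odd_coeff n)"
  using fps_X_power_mult_shift[OF fps_X_power_dvd_kernel_series[OF odd_coeff_less]]
  by (simp add: T_solution_def)

lemma T_solution_0: "T_solution 0 = 1"
proof -
  have "kernel_series p (even_coeff 0) = (\<Sum>k\<in>{0}. fps_const (p ^ k * even_coeff 0 k) * kernel p k)"
    unfolding kernel_series_def by (rule suminf_finite) auto
  then have "T_solution 0 = (1 + fps_X) * kernel p 0"
    using T_solution_even[of 0] by simp
  then show ?thesis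
    by (simp only: kernel_0_mult)
qed

lemma T_solution_1: "T_solution 1 = Abs_fps (theta_coeff y q)"
proof -
  have "odd_coeff 0 = odd_lam_prod 0"
    by (simp add: odd_coeff_def fun_eq_iff)
  then show ?thesis
    using T_solution_odd[of 0] by (simp add: theta_series_eq_kernel_series)
qed

lemma T_solution_even_recurrence:
  "T_solution (2 * n) = (1 + fps_X) * T_solution (Suc (2 * n))
     - fps_const (lam y q (Suc (2 * n))) * fps_X * T_solution (2 * Suc n)"
proof -
  have "even_coeff n = (\<lambda>k. odd_coeff n k - lam y q (Suc (2 * n)) * even_coeff (Suc n) k)"
    by (rule ext) (rule even_coeff_recurrence)
  then have "kernel_series p (even_coeff n) = kernel_series p (odd_coeff n)
      - fps_const (lam y q (Suc (2 * n))) * kernel_series p (even_coeff (Suc n))"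
    by (metis kernel_series_diff)
  then have "fps_X ^ n * T_solution (2 * n) = (1 + fps_X) * (fps_X ^ n * T_solution (Suc (2 * n)))
      - fps_const (lam y q (Suc (2 * n))) * (fps_X ^ Suc n * T_solution (2 * Suc n))"
    unfolding T_solution_even T_solution_odd by (simp only: right_diff_distrib mult.left_commute)
  then have "fps_X ^ n * T_solution (2 * n) =
      fps_X ^ n * ((1 + fps_X) * T_solution (Suc (2 * n))
      - fps_const (lam y q (Suc (2 * n))) * fps_X * T_solution (2 * Suc n))"
    by (simp only: power_Suc algebra_simps)
  then show ?thesis
    by simp
qed

lemma T_solution_odd_recurrence:
  "T_solution (Suc (2 * n)) = (1 + fps_X) * T_solution (2 * Suc n)
     - fps_const (lam y q (2 * Suc n)) * fps_X * T_solution (Suc (2 * Suc n))"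
proof -
  have "(1 + fps_X)\<^sup>2 * kernel_series p (even_coeff (Suc n)) =
      fps_X * kernel_series p (\<lambda>k. odd_coeff n k - (- lam y q (2 * Suc n)) * odd_coeff (Suc n) k)"
    using odd_coeff_recurrence[of _ n] p_nonzero by (intro kernel_series_recurrence) simp_all
  then have "(1 + fps_X)\<^sup>2 * kernel_series p (even_coeff (Suc n)) =
      fps_X * (kernel_series p (odd_coeff n)
        + fps_const (lam y q (2 * Suc n)) * kernel_series p (odd_coeff (Suc n)))"
    by (simp only: kernel_series_diff) (simp flip: fps_const_neg)
  then have "(1 + fps_X) * (fps_X ^ Suc n * T_solution (2 * Suc n)) =
      fps_X * (fps_X ^ n * T_solution (Suc (2 * n))
        + fps_const (lam y q (2 * Suc n)) * (fps_X ^ Suc n * T_solution (Suc (2 * Suc n))))"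
    unfolding T_solution_even T_solution_odd by (simp only: power2_eq_square mult.assoc)
  then have "fps_X ^ Suc n * T_solution (Suc (2 * n)) =
      fps_X ^ Suc n * ((1 + fps_X) * T_solution (2 * Suc n)
      - fps_const (lam y q (2 * Suc n)) * fps_X * T_solution (Suc (2 * Suc n)))"
    by (simp only: power_Suc algebra_simps)
  then show ?thesis
    by simp
qed

theorem T_fraction_has_value_theta_series:
  "T_fraction_has_value (lam y q) (Abs_fps (theta_coeff y q))"
proof -
  have "T_solution m = (1 + fps_X) * T_solution (Suc m)
      - fps_const (lam y q (Suc m)) * fps_X * T_solution (Suc (Suc m))" for m
    using T_solution_even_recurrence[of "m div 2"] T_solution_odd_recurrence[of "m div 2"]
    by (cases "even m") (simp_all add: odd_two_times_div_two_succ)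
  from T_fraction_has_valueI[of T_solution, OF T_solution_0 this] show ?thesis
    by (simp only: T_solution_1)
qed

end

theorem theorem7p1:
  shows "T_fraction_has_value (lam y_ind q_ind)
    (Abs_fps (\<lambda>k. \<Sum>j = - int k..int k.
       y_ind powi j * q_ind powi (int k * (int k + 1) - j\<^sup>2)))"
proof -
  interpret theta_T_fraction y_ind q_ind "q_ind\<^sup>2"
    by unfold_locales (simp_all add: q_ind_def y_ind_def flip: to_fract_def)
  show ?thesis
    using T_fraction_has_value_theta_series by (simp only: theta_coeff_def[abs_def])
qed

end
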